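(* Let $\theta$ be a standardized holey $\{\exists,\wedge\}$-formula of the form $\phi\wedge\phi'$, and let $a$ be an association for $\theta$. Then $\mathsf{width}([\phi\wedge\phi']_{\mathcal{T}\setminus\{N\}})=\max\big(\mathsf{width}([\phi]_{\mathcal{T}\setminus\{N\}}),\ \mathsf{width}([\phi']_{\mathcal{T}\setminus\{N\}}),\ |\mathrm{free}(\phi)\cup\mathrm{free}(\phi')|\big).$
   Context: A holey pfo-formula is built as follows: each natural number $i\ge1$ is a holey formula (a hole); if $\phi,\phi'$ are holey formulas, so are $\phi\wedge\phi'$, $\phi\vee\phi'$, $\exists x\phi$, $\forall x\phi$; no natural number may occur more than once. A holey $\{\exists,\wedge\}$-formula uses only holes, $\wedge$ and $\exists$. An association for a holey formula is a partial map $a$ defined on all its holes, with $a(i)$ a set of variables; it determines $\mathrm{free}(\cdot)$ on all subformulas via $\mathrm{free}(i)=a(i)$ and the usual inductive rules. The width of a (holey) formula is the maximum of $|\mathrm{free}(\psi)|$ over its subformulas $\psi$; for a set $S$ of formulas, $\mathsf{width}(S)=\inf\{\mathsf{width}(\psi):\psi\in S\}$. A formula is standardized if for each occurrence of a quantification $Qx$, $x$ is quantified at no other occurrence and $x$ is not free in the whole formula. Rewriting rules (applicable to any subformula occurrence, free variables computed via the association; $\oplus\in\{\wedge,\vee\}$, $Q\in\{\exists,\forall\}$): $A$: $F_1\oplus(F_2\oplus F_3)\to(F_1\oplus F_2)\oplus F_3$ and its converse; $C$: $F_1\oplus F_2\to F_2\oplus F_1$; $O$: $QxQyF\to QyQxF$;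 $P\!\downarrow$: $\exists x(F_1\wedge F_2)\to(\exists xF_1)\wedge F_2$ and $\forall x(F_1\vee F_2)\to(\forall xF_1)\vee F_2$ whenever $x\notin\mathrm{free}(F_2)$; $P\!\uparrow$: inverse of $P\!\downarrow$. $[\psi]_{\mathcal{T}\setminus\{N\}}$ is the equivalence class of $\psi$ under the reflexive-transitive closure of the union of the rules $A,C,O,P\!\downarrow,P\!\uparrow$ and their inverses (for $\phi,\phi'$ the association is the restriction of $a$). *)

theory Defs
  imports "HOL-Library.Extended_Nat"
begin

datatype connective = Conj | Disj

datatype quantifier = Exists | Forall

datatype 'v formula =
    Hole nat
  | Bin connective "'v formula" "'v formula"
  | Quant quantifier 'v "'v formula"

text \<open>Lists rather than sets, so that multiple occurrences remain visible.\<close>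

primrec hole_list :: "'v formula \<Rightarrow> nat list" where
  "hole_list (Hole i) = [i]"
| "hole_list (Bin c F G) = hole_list F @ hole_list G"
| "hole_list (Quant Q x F) = hole_list F"

primrec quant_list :: "'v formula \<Rightarrow> 'v list" where
  "quant_list (Hole i) = []"
| "quant_list (Bin c F G) = quant_list F @ quant_list G"
| "quant_list (Quant Q x F) = x # quant_list F"

abbreviation holes :: "'v formula \<Rightarrow> nat set" where
  "holes F \<equiv> set (hole_list F)"

text \<open>The datatype also contains terms with a hole numbered 0 or with a repeated hole;
  these are excluded here.\<close>

definition holey :: "'v formula \<Rightarrow> bool" where
  "holey F \<longleftrightarrow> (\<forall>i \<in> holes F. 1 \<le> i) \<and> distinct (hole_list F)"

primrec only_exists_conj :: "'v formula \<Rightarrow> bool" where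
  "only_exists_conj (Hole i) \<longleftrightarrow> True"
| "only_exists_conj (Bin c F G) \<longleftrightarrow> c = Conj \<and> only_exists_conj F \<and> only_exists_conj G"
| "only_exists_conj (Quant Q x F) \<longleftrightarrow> Q = Exists \<and> only_exists_conj F"

definition holey_exists_conj :: "'v formula \<Rightarrow> bool" where
  "holey_exists_conj F \<longleftrightarrow> holey F \<and> only_exists_conj F"

definition association :: "(nat \<rightharpoonup> 'v set) \<Rightarrow> 'v formula \<Rightarrow> bool" where
  "association a F \<longleftrightarrow> holes F \<subseteq> dom a"

text \<open>The value of \<open>free a F\<close> is meaningful only if \<open>a\<close> is an association for \<open>F\<close>.\<close>

primrec free :: "(nat \<rightharpoonup> 'v set) \<Rightarrow> 'v formula \<Rightarrow> 'v set" where
  "free a (Hole i) = the (a i)"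
| "free a (Bin c F G) = free a F \<union> free a G"
| "free a (Quant Q x F) = free a F - {x}"

definition standardized :: "(nat \<rightharpoonup> 'v set) \<Rightarrow> 'v formula \<Rightarrow> bool" where
  "standardized a F \<longleftrightarrow> distinct (quant_list F) \<and> set (quant_list F) \<inter> free a F = {}"

primrec subformulas :: "'v formula \<Rightarrow> 'v formula set" where
  "subformulas (Hole i) = {Hole i}"
| "subformulas (Bin c F G) = insert (Bin c F G) (subformulas F \<union> subformulas G)"
| "subformulas (Quant Q x F) = insert (Quant Q x F) (subformulas F)"

text \<open>Sets assigned to holes need not be finite, and \<open>card\<close> maps infinite sets to 0;
  hence cardinalities and widths are taken in the extended naturals.\<close>

definition ecard :: "'b set \<Rightarrow> enat" where
  "ecard A = (if finite A then enat (card A) else \<infinity>)"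

definition width :: "(nat \<rightharpoonup> 'v set) \<Rightarrow> 'v formula \<Rightarrow> enat" where
  "width a F = Max ((\<lambda>G. ecard (free a G)) ` subformulas F)"

definition width_set :: "(nat \<rightharpoonup> 'v set) \<Rightarrow> 'v formula set \<Rightarrow> enat" where
  "width_set a S = (INF F \<in> S. width a F)"

inductive root_step :: "(nat \<rightharpoonup> 'v set) \<Rightarrow> 'v formula \<Rightarrow> 'v formula \<Rightarrow> bool"
  for a :: "nat \<rightharpoonup> 'v set" where
  A_left: "root_step a (Bin c F1 (Bin c F2 F3)) (Bin c (Bin c F1 F2) F3)"
| A_right: "root_step a (Bin c (Bin c F1 F2) F3) (Bin c F1 (Bin c F2 F3))"
| C: "root_step a (Bin c F1 F2) (Bin c F2 F1)"
| O: "root_step a (Quant Q x (Quant Q y F)) (Quant Q y (Quant Q x F))"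
| P_down_exists: "x \<notin> free a F2 \<Longrightarrow>
    root_step a (Quant Exists x (Bin Conj F1 F2)) (Bin Conj (Quant Exists x F1) F2)"
| P_down_forall: "x \<notin> free a F2 \<Longrightarrow>
    root_step a (Quant Forall x (Bin Disj F1 F2)) (Bin Disj (Quant Forall x F1) F2)"
| P_up_exists: "x \<notin> free a F2 \<Longrightarrow>
    root_step a (Bin Conj (Quant Exists x F1) F2) (Quant Exists x (Bin Conj F1 F2))"
| P_up_forall: "x \<notin> free a F2 \<Longrightarrow>
    root_step a (Bin Disj (Quant Forall x F1) F2) (Quant Forall x (Bin Disj F1 F2))"

inductive step :: "(nat \<rightharpoonup> 'v set) \<Rightarrow> 'v formula \<Rightarrow> 'v formula \<Rightarrow> bool"
  for a :: "nat \<rightharpoonup> 'v set" where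
  root: "root_step a F G \<Longrightarrow> step a F G"
| Bin_left: "step a F G \<Longrightarrow> step a (Bin c F H) (Bin c G H)"
| Bin_right: "step a F G \<Longrightarrow> step a (Bin c H F) (Bin c H G)"
| Quant: "step a F G \<Longrightarrow> step a (Quant Q x F) (Quant Q x G)"

text \<open>The class \<open>[F]\<close> with respect to all rules except renaming of bound variables (\<open>N\<close>),
  computed under the association \<open>a\<close>.\<close>

definition eq_class :: "(nat \<rightharpoonup> 'v set) \<Rightarrow> 'v formula \<Rightarrow> 'v formula set" where
  "eq_class a F = {G. equivclp (step a) F G}"

end

theory Submission
  imports Defs
begin

text \<open>Only the lower bound needs an idea. Given a formula \<open>\<Psi>\<close> in the class of \<open>\<phi> \<and> \<phi>'\<close>, delete all
  holes outside \<open>\<phi>\<close>, together with every quantifier that has become vacuous. This does not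
  increase the width, and it maps each rewriting step to at most one rewriting step; so the result
  is equivalent to \<open>\<phi>\<close> stripped of its vacuous quantifiers. Vacuous quantifiers may migrate
  between \<open>\<phi>\<close> and \<open>\<phi>'\<close> in the course of the rewriting, which is why they are deleted. They are put
  back in front of the formula, where they cost no width; in a standardized formula they can be
  pulled there.\<close>

section \<open>Invariants of rewriting\<close>

lemma step_free: "step a F G \<Longrightarrow> free a F = free a G"
proof (induction rule: step.induct)
  case (root F G)
  then show ?case by cases auto
qed auto

lemma step_holes: "step a F G \<Longrightarrow> holes F = holes G"
proof (induction rule: step.induct)
  case (root F G)
  then show ?case by cases auto
qed auto

lemma equivclp_free: "equivclp (step a) F G \<Longrightarrow> free a F = free a G"
  by (induction rule: equivclp_induct) (auto dest: step_free)

lemma equivclp_map: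
  assumes "equivclp r x y" and "\<And>x y. r x y \<Longrightarrow> equivclp s (f x) (f y)"
  shows "equivclp s (f x) (f y)"
  using assms(1)
proof (induction rule: equivclp_induct)
  case (step y z)
  then have "equivclp s (f y) (f z)" by (blast intro: assms(2) equivclp_sym)
  with step.IH show ?case by (rule equivclp_trans)
qed simp

lemma equivclp_Quant: "equivclp (step a) F G \<Longrightarrow> equivclp (step a) (Quant Q x F) (Quant Q x G)"
  by (erule equivclp_map) (blast intro: step.intros)

lemma equivclp_Bin:
  assumes "equivclp (step a) F F'" "equivclp (step a) G G'"
  shows "equivclp (step a) (Bin c F G) (Bin c F' G')"
proof -
  have "equivclp (step a) (Bin c F G) (Bin c F' G)"
    using assms(1) by (rule equivclp_map) (blast intro: step.intros)
  also have "equivclp (step a) (Bin c F' G) (Bin c F' G')"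
    using assms(2) by (rule equivclp_map) (blast intro: step.intros)
  finally show ?thesis .
qed

lemma equivclp_Bin_commute: "equivclp (step a) (Bin c F G) (Bin c G F)"
  by (blast intro: step.root root_step.C)

section \<open>Independence of the association outside the holes\<close>

lemma free_restrict_map: "holes F \<subseteq> H \<Longrightarrow> free (a |` H) F = free a F"
  by (induction F) (auto simp: restrict_map_def)

text \<open>The rules consult the association only in the side conditions of the P rules, and there
  only through the free variables of a subformula, whose holes all lie in \<open>H\<close>.\<close>

lemma step_restrict_map: "holes F \<subseteq> H \<Longrightarrow> step (a |` H) F G \<longleftrightarrow> step a F G"
proof
  assume "step (a |` H) F G" "holes F \<subseteq> H"
  then show "step a F G"
  proof (induction rule: step.induct)
    case (root F G)
    then show ?case
      by cases (auto intro!: step.root root_step.intros simp: free_restrict_map)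
  qed (auto intro: step.intros)
next
  assume "step a F G" "holes F \<subseteq> H"
  then show "step (a |` H) F G"
  proof (induction rule: step.induct)
    case (root F G)
    then show ?case
      by cases (auto intro!: step.root root_step.intros simp: free_restrict_map)
  qed (auto intro: step.intros)
qed

text \<open>The invariant \<open>P\<close> confines the whole chain to elements on which
  \<open>r\<close> implies \<open>s\<close>. It must be preserved in both directions because the
  chain may also run against \<open>r\<close>.\<close>

lemma equivclp_transfer:
  assumes "equivclp r x y" and "P x"
    and "\<And>x y. r x y \<Longrightarrow> P x \<longleftrightarrow> P y" and "\<And>x y. r x y \<Longrightarrow> P x \<Longrightarrow> s x y"
  shows "equivclp s x y"
proof -
  have "equivclp s x y \<and> P y"
    using assms(1)
  proof (induction rule: equivclp_induct)
    case base
    then show ?case by (simp add: assms(2))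
  next
    case (step y z)
    from step.hyps(2) have "P z" "equivclp s y z"
      using step.IH assms(3,4) by (blast intro: equivclp_sym)+
    with step.IH show ?case by (blast intro: equivclp_trans)
  qed
  then show ?thesis ..
qed

lemma eq_class_restrict_map: "eq_class (a |` holes F) F = eq_class a F"
proof -
  let ?H = "holes F"
  have "equivclp (step (a |` ?H)) F G \<longleftrightarrow> equivclp (step a) F G" for G
  proof
    assume "equivclp (step (a |` ?H)) F G"
    then show "equivclp (step a) F G"
      by (rule equivclp_transfer[where P = "\<lambda>G. holes G \<subseteq> ?H"])
        (auto simp: step_holes step_restrict_map)
  next
    assume "equivclp (step a) F G"
    then show "equivclp (step (a |` ?H)) F G"
      by (rule equivclp_transfer[where P = "\<lambda>G. holes G \<subseteq> ?H"])
        (auto simp: step_holes step_restrict_map)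
  qed
  then show ?thesis by (simp add: eq_class_def)
qed

lemma eq_class_holes:
  assumes "G \<in> eq_class a F"
  shows "holes G = holes F"
proof -
  have "equivclp (step a) F G" using assms by (simp add: eq_class_def)
  then show ?thesis by (induction rule: equivclp_induct) (auto dest: step_holes)
qed

section \<open>Width\<close>

lemma ecard_mono: "A \<subseteq> B \<Longrightarrow> ecard A \<le> ecard B"
  by (auto simp: ecard_def card_mono dest: finite_subset)

lemma finite_subformulas [simp]: "finite (subformulas F)"
  by (induction F) auto

lemma subformulas_nonempty [simp]: "subformulas F \<noteq> {}"
  by (cases F) auto

lemma width_simps [simp]:
  "width a (Hole i) = ecard (the (a i))"
  "width a (Bin c F G) = max (ecard (free a F \<union> free a G)) (max (width a F) (width a G))"
  "width a (Quant Q x F) = max (ecard (free a F - {x})) (width a F)"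
  by (simp_all add: width_def image_Un Max_Un)

lemma ecard_free_le_width: "ecard (free a F) \<le> width a F"
  by (cases F) auto

text \<open>The body is itself a subformula and has at least as many free variables as the
  quantified formula.\<close>

lemma width_Quant: "width a (Quant Q x F) = width a F"
proof -
  have "ecard (free a F - {x}) \<le> ecard (free a F)" by (rule ecard_mono) blast
  also have "\<dots> \<le> width a F" by (rule ecard_free_le_width)
  finally show ?thesis by (simp add: max_def)
qed

lemma width_foldr_Quant: "width a (foldr (Quant Q) xs F) = width a F"
  by (induction xs) (simp_all add: width_Quant del: width_simps(3))

lemma width_restrict_map: "holes F \<subseteq> H \<Longrightarrow> width (a |` H) F = width a F"
  by (induction F) (auto simp: free_restrict_map)

lemma width_set_restrict_map:
  "width_set (a |` holes F) (eq_class (a |` holes F) F) = width_set a (eq_class a F)"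
  unfolding width_set_def eq_class_restrict_map
  by (rule INF_cong) (auto simp: width_restrict_map eq_class_holes)

lemma width_set_attained:
  assumes "S \<noteq> {}"
  obtains F where "F \<in> S" "width a F = width_set a S"
proof -
  \<comment> \<open>\<open>enat\<close> is well-ordered, so the infimum of a nonempty set is its
    least element.\<close>
  from assms have "width_set a S \<in> width a ` S"
    unfolding width_set_def Inf_enat_def by (auto intro: LeastI)
  then show ?thesis by (metis imageE that)
qed

lemma self_in_eq_class: "F \<in> eq_class a F"
  by (simp add: eq_class_def)

section \<open>Restriction to a set of holes\<close>

text \<open>\<open>None\<close> stands for a formula without holes, which the datatype cannot
  express; it is neutral for both connectives.\<close>

fun Bin_option :: "connective \<Rightarrow> 'v formula option \<Rightarrow> 'v formula option \<Rightarrow> 'v formula option" where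
  "Bin_option c (Some F) (Some G) = Some (Bin c F G)"
| "Bin_option c (Some F) None = Some F"
| "Bin_option c None G = G"

text \<open>Vacuity is tested on the restricted body \<open>F'\<close>, so that quantifiers losing
  their variable through the deletion go, as well as those vacuous from the start.\<close>

primrec restrict_formula :: "(nat \<rightharpoonup> 'v set) \<Rightarrow> nat set \<Rightarrow> 'v formula \<Rightarrow> 'v formula option" where
  "restrict_formula a H (Hole i) = (if i \<in> H then Some (Hole i) else None)"
| "restrict_formula a H (Bin c F G) = Bin_option c (restrict_formula a H F) (restrict_formula a H G)"
| "restrict_formula a H (Quant Q x F) =
    map_option (\<lambda>F'. if x \<in> free a F' then Quant Q x F' else F') (restrict_formula a H F)"

text \<open>A dropped quantifier binds nothing in the restricted body, so no variable becomes free.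
  Hence the side conditions of the P rules survive restriction.\<close>

lemma free_restrict_formula: "restrict_formula a H F = Some F' \<Longrightarrow> free a F' \<subseteq> free a F"
proof (induction F arbitrary: F')
  case (Bin c F G)
  then show ?case
    by (cases "restrict_formula a H F"; cases "restrict_formula a H G") fastforce+
next
  case (Quant Q x F)
  then show ?case by (fastforce split: if_splits)
qed (auto split: if_splits)

lemma width_restrict_formula: "restrict_formula a H F = Some F' \<Longrightarrow> width a F' \<le> width a F"
proof (induction F arbitrary: F')
  case (Bin c F G)
  then have "ecard (free a F') \<le> ecard (free a F \<union> free a G)"
    using free_restrict_formula[OF Bin.prems] by (simp add: ecard_mono)
  with Bin show ?case
    by (cases "restrict_formula a H F"; cases "restrict_formula a H G")
      (fastforce simp: le_max_iff_disj)+
next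
  case (Quant Q x F)
  then show ?case by (auto simp: width_Quant simp del: width_simps(3) split: if_splits)
qed (auto split: if_splits)

lemma restrict_formula_eq_None: "holes F \<inter> H = {} \<Longrightarrow> restrict_formula a H F = None"
  by (induction F) (auto simp: Int_Un_distrib2)

text \<open>Each rule turns into itself or into the identity. For the P rules: if \<open>F2\<close>
  disappears, both sides coincide; if \<open>F1\<close> disappears or its restriction lacks
  \<open>x\<close>, both sides lose the quantifier, since \<open>x\<close> is not free in what
  remains of \<open>F2\<close>.\<close>

lemma restrict_formula_root_step:
  assumes "root_step a F G"
  shows "rel_option (equivclp (step a)) (restrict_formula a H F) (restrict_formula a H G)"
  using assms
proof cases
  case (A_left c F1 F2 F3)
  then show ?thesis
    by (cases "restrict_formula a H F1"; cases "restrict_formula a H F2"; cases "restrict_formula a H F3")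
      (auto intro: step.root root_step.intros)
next
  case (A_right c F1 F2 F3)
  then show ?thesis
    by (cases "restrict_formula a H F1"; cases "restrict_formula a H F2"; cases "restrict_formula a H F3")
      (auto intro: step.root root_step.intros)
next
  case (C c F1 F2)
  then show ?thesis
    by (cases "restrict_formula a H F1"; cases "restrict_formula a H F2")
      (auto intro: step.root root_step.intros)
next
  case (O Q x y F)
  then show ?thesis
    by (cases "restrict_formula a H F") (auto intro: step.root root_step.intros)
next
  case (P_down_exists x F2 F1)
  then show ?thesis
    using free_restrict_formula[of a H F2]
    by (cases "restrict_formula a H F1"; cases "restrict_formula a H F2")
      (auto intro!: r_into_equivclp step.root root_step.intros)
next
  case (P_down_forall x F2 F1)
  then show ?thesis
    using free_restrict_formula[of a H F2]
    by (cases "restrict_formula a H F1"; cases "restrict_formula a H F2")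
      (auto intro!: r_into_equivclp step.root root_step.intros)
next
  case (P_up_exists x F2 F1)
  then show ?thesis
    using free_restrict_formula[of a H F2]
    by (cases "restrict_formula a H F1"; cases "restrict_formula a H F2")
      (auto intro!: r_into_equivclp step.root root_step.intros)
next
  case (P_up_forall x F2 F1)
  then show ?thesis
    using free_restrict_formula[of a H F2]
    by (cases "restrict_formula a H F1"; cases "restrict_formula a H F2")
      (auto intro!: r_into_equivclp step.root root_step.intros)
qed

lemma restrict_formula_step:
  "step a F G \<Longrightarrow>
    rel_option (equivclp (step a)) (restrict_formula a H F) (restrict_formula a H G)"
proof (induction rule: step.induct)
  case (root F G)
  then show ?case by (rule restrict_formula_root_step)
next
  case (Bin_left F G c K)
  then show ?case
    by (cases "restrict_formula a H K") (auto elim!: option.rel_cases intro!: equivclp_Bin)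
next
  case (Bin_right F G c K)
  then show ?case
    by (cases "restrict_formula a H K") (auto elim!: option.rel_cases intro!: equivclp_Bin)
next
  \<comment> \<open>Equivalent bodies have the same free variables, so both sides keep the
    quantifier or both drop it.\<close>
  case (Quant F G Q x)
  then show ?case
    by (auto elim!: option.rel_cases intro!: equivclp_Quant simp: equivclp_free)
qed

lemma restrict_formula_equivclp:
  "equivclp (step a) F G \<Longrightarrow>
    rel_option (equivclp (step a)) (restrict_formula a H F) (restrict_formula a H G)"
proof (induction rule: equivclp_induct)
  case base
  show ?case by (simp add: option.rel_refl)
next
  case (step F' G')
  then have "rel_option (equivclp (step a)) (restrict_formula a H F') (restrict_formula a H G')"
    by (auto dest!: restrict_formula_step[of _ _ _ H]
        simp: option.rel_sel intro: equivclp_sym)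
  with step.IH show ?case
    by (auto simp: option.rel_sel intro: equivclp_trans)
qed

section \<open>Pulling vacuous quantifiers to the front\<close>

lemma pull_Exists:
  assumes "set xs \<inter> free a G = {}"
  shows "equivclp (step a) (Bin Conj (foldr (Quant Exists) xs F) G)
    (foldr (Quant Exists) xs (Bin Conj F G))"
  using assms
proof (induction xs)
  case (Cons x xs)
  have "equivclp (step a) (Bin Conj (Quant Exists x (foldr (Quant Exists) xs F)) G)
      (Quant Exists x (Bin Conj (foldr (Quant Exists) xs F) G))"
    using Cons.prems by (auto intro!: r_into_equivclp step.root root_step.intros)
  also have "equivclp (step a) \<dots> (Quant Exists x (foldr (Quant Exists) xs (Bin Conj F G)))"
    using Cons by (intro equivclp_Quant) auto
  finally show ?case by simp
qed simp

lemma equivclp_foldr_Quant: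
  "equivclp (step a) F G \<Longrightarrow> equivclp (step a) (foldr (Quant Q) xs F) (foldr (Quant Q) xs G)"
  by (induction xs) (auto intro: equivclp_Quant)

text \<open>Serves to move a quantifier that is kept inside the block of vacuous ones.\<close>

lemma Quant_foldr_swap:
  "equivclp (step a) (Quant Q x (foldr (Quant Q) xs F)) (foldr (Quant Q) xs (Quant Q x F))"
proof (induction xs)
  case (Cons y xs)
  have "equivclp (step a) (Quant Q x (Quant Q y (foldr (Quant Q) xs F)))
      (Quant Q y (Quant Q x (foldr (Quant Q) xs F)))"
    by (auto intro!: r_into_equivclp step.root root_step.intros)
  also have "equivclp (step a) \<dots> (Quant Q y (foldr (Quant Q) xs (Quant Q x F)))"
    using Cons by (rule equivclp_Quant)
  finally show ?case by simp
qed simp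

lemma standardized_BinD:
  assumes "standardized a (Bin c F G)"
  shows "standardized a F" "standardized a G"
    "set (quant_list F) \<inter> free a G = {}" "set (quant_list G) \<inter> free a F = {}"
  using assms by (auto simp: standardized_def)

text \<open>\<open>x\<close> may become free in \<open>F\<close>, but distinctness keeps it out of
  the variables quantified there.\<close>

lemma standardized_QuantD: "standardized a (Quant Q x F) \<Longrightarrow> standardized a F"
  by (auto simp: standardized_def)

text \<open>No hole is deleted, so only vacuous quantifiers disappear; \<open>xs\<close> collects
  them. The bound on \<open>xs\<close> lets standardization act in the induction: variables
  quantified in one conjunct are not free in the other, so the block can be pulled out.\<close>

lemma restrict_formula_all_holes:
  assumes "only_exists_conj F" "standardized a F" "holes F \<subseteq> H"
  obtains F' xs where "restrict_formula a H F = Some F'" "set xs \<subseteq> set (quant_list F)"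
    "equivclp (step a) F (foldr (Quant Exists) xs F')"
  using assms
proof (induction F arbitrary: thesis)
  case (Hole i)
  then show ?case by (auto intro: Hole.prems(1)[where xs = "[]"])
next
  case (Bin c F G)
  note std = standardized_BinD[OF Bin.prems(3)]
  obtain F' xs where F: "restrict_formula a H F = Some F'" "set xs \<subseteq> set (quant_list F)"
    "equivclp (step a) F (foldr (Quant Exists) xs F')"
    by (rule Bin.IH(1)) (use Bin.prems std in auto)
  obtain G' ys where G: "restrict_formula a H G = Some G'" "set ys \<subseteq> set (quant_list G)"
    "equivclp (step a) G (foldr (Quant Exists) ys G')"
    by (rule Bin.IH(2)) (use Bin.prems std in auto)
  have "equivclp (step a) (Bin Conj F G) (Bin Conj (foldr (Quant Exists) xs F') G)"
    using F(3) by (rule equivclp_Bin) simp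
  also have "equivclp (step a) \<dots> (foldr (Quant Exists) xs (Bin Conj F' G))"
    using F(2) std by (intro pull_Exists) auto
  also have "equivclp (step a) \<dots> (foldr (Quant Exists) xs (foldr (Quant Exists) ys (Bin Conj F' G')))"
  proof (rule equivclp_foldr_Quant)
    \<comment> \<open>\<open>pull_Exists\<close> acts on the left operand, so the conjunction is
      swapped first and swapped back under the quantifiers. The variables \<open>ys\<close> avoid
      \<open>free a F\<close>, hence also \<open>free a F'\<close>.\<close>
    have "equivclp (step a) (Bin Conj F' G) (Bin Conj (foldr (Quant Exists) ys G') F')"
      using equivclp_Bin[OF equivclp_refl G(3)] equivclp_Bin_commute by (rule equivclp_trans)
    also have "equivclp (step a) \<dots> (foldr (Quant Exists) ys (Bin Conj G' F'))"
      using G(2) std free_restrict_formula[OF F(1)] by (intro pull_Exists) auto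
    also have "equivclp (step a) \<dots> (foldr (Quant Exists) ys (Bin Conj F' G'))"
      by (intro equivclp_foldr_Quant equivclp_Bin_commute)
    finally show "equivclp (step a) (Bin Conj F' G) (foldr (Quant Exists) ys (Bin Conj F' G'))" .
  qed
  finally have "equivclp (step a) (Bin Conj F G) (foldr (Quant Exists) (xs @ ys) (Bin Conj F' G'))"
    by simp
  with F G Bin.prems(2) show ?case
    by (intro Bin.prems(1)[where xs = "xs @ ys"]) auto
next
  case (Quant Q x F)
  obtain F' xs where F: "restrict_formula a H F = Some F'" "set xs \<subseteq> set (quant_list F)"
    "equivclp (step a) F (foldr (Quant Exists) xs F')"
    by (rule Quant.IH) (use Quant.prems standardized_QuantD in auto)
  have Q: "Q = Exists" using Quant.prems by simp
  have eq: "equivclp (step a) (Quant Q x F) (Quant Q x (foldr (Quant Exists) xs F'))"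
    using F(3) by (rule equivclp_Quant)
  show ?case
  proof (cases "x \<in> free a F'")
    case True
    show ?thesis
    proof (rule Quant.prems(1))
      show "restrict_formula a H (Quant Q x F) = Some (Quant Q x F')"
        using True F(1) by simp
      show "set xs \<subseteq> set (quant_list (Quant Q x F))" using F(2) by auto
      show "equivclp (step a) (Quant Q x F) (foldr (Quant Exists) xs (Quant Q x F'))"
        using eq Quant_foldr_swap unfolding Q by (rule equivclp_trans)
    qed
  next
    \<comment> \<open>The restriction drops this quantifier, so it joins the block in front.\<close>
    case False
    then show ?thesis
      using F eq Q by (intro Quant.prems(1)[where xs = "x # xs"]) auto
  qed
qed

lemma width_set_conjunct_le:
  assumes "only_exists_conj \<phi>" "standardized a \<phi>" "holes \<phi> \<inter> holes \<phi>' = {}"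
    and "equivclp (step a) (Bin Conj \<phi> \<phi>') \<psi>"
  shows "width_set a (eq_class a \<phi>) \<le> width a \<psi>"
proof -
  let ?H = "holes \<phi>"
  obtain F xs where F: "restrict_formula a ?H \<phi> = Some F"
    "equivclp (step a) \<phi> (foldr (Quant Exists) xs F)"
    using restrict_formula_all_holes[OF assms(1,2) order_refl] by metis
  \<comment> \<open>The second conjunct vanishes entirely, so the whole conjunction restricts to
    \<open>F\<close>.\<close>
  have "restrict_formula a ?H \<phi>' = None"
    using assms(3) by (intro restrict_formula_eq_None) auto
  with F(1) have "rel_option (equivclp (step a)) (Some F) (restrict_formula a ?H \<psi>)"
    using restrict_formula_equivclp[OF assms(4), of ?H] by simp
  then obtain G where G: "restrict_formula a ?H \<psi> = Some G" "equivclp (step a) F G"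
    by (auto simp: option_rel_Some1)
  \<comment> \<open>The quantifiers stripped from \<open>\<phi>\<close> are put in front of the
    restriction of \<open>\<psi>\<close>; this yields a member of the class of \<open>\<phi>\<close>
    no wider than \<open>\<psi>\<close>.\<close>
  have "equivclp (step a) \<phi> (foldr (Quant Exists) xs G)"
    using F(2) equivclp_foldr_Quant[OF G(2)] by (rule equivclp_trans)
  then have "width_set a (eq_class a \<phi>) \<le> width a (foldr (Quant Exists) xs G)"
    unfolding width_set_def eq_class_def by (intro INF_lower) simp
  also have "\<dots> \<le> width a \<psi>"
    using width_restrict_formula[OF G(1)] by (simp add: width_foldr_Quant)
  finally show ?thesis .
qed

theorem theorem9p1:
  fixes \<theta> \<phi> \<phi>' :: "'v formula" and a :: "nat \<rightharpoonup> 'v set"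
  assumes "holey_exists_conj \<theta>"
    and "association a \<theta>"
    and "standardized a \<theta>"
    and "\<theta> = Bin Conj \<phi> \<phi>'"
  shows "width_set a (eq_class a \<theta>) =
    max (width_set (a |` holes \<phi>) (eq_class (a |` holes \<phi>) \<phi>))
      (max (width_set (a |` holes \<phi>') (eq_class (a |` holes \<phi>') \<phi>'))
        (ecard (free a \<phi> \<union> free a \<phi>')))"
proof -
  have conj: "only_exists_conj \<phi>" "only_exists_conj \<phi>'" and
    disj: "holes \<phi> \<inter> holes \<phi>' = {}" "holes \<phi>' \<inter> holes \<phi> = {}"
    using assms(1,4) by (auto simp: holey_exists_conj_def holey_def)
  have std: "standardized a \<phi>" "standardized a \<phi>'"
    using assms(3,4) by (auto dest: standardized_BinD)
  \<comment> \<open>The equation is first proved under the single association \<open>a\<close>; the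
    restricted associations enter only at the end.\<close>
  have "width_set a (eq_class a \<theta>) = max (width_set a (eq_class a \<phi>))
      (max (width_set a (eq_class a \<phi>')) (ecard (free a \<phi> \<union> free a \<phi>')))"
  proof (rule antisym)
    \<comment> \<open>Upper bound: rewriting inside each conjunct separately reaches the conjunction
      of two members of least width.\<close>
    obtain \<psi> where \<psi>: "\<psi> \<in> eq_class a \<phi>" "width a \<psi> = width_set a (eq_class a \<phi>)"
      using self_in_eq_class by (metis empty_iff width_set_attained)
    obtain \<psi>' where \<psi>': "\<psi>' \<in> eq_class a \<phi>'" "width a \<psi>' = width_set a (eq_class a \<phi>')"
      using self_in_eq_class by (metis empty_iff width_set_attained)
    have "Bin Conj \<psi> \<psi>' \<in> eq_class a \<theta>"
      using \<psi>(1) \<psi>'(1) assms(4) by (simp add: eq_class_def equivclp_Bin)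
    then have "width_set a (eq_class a \<theta>) \<le> width a (Bin Conj \<psi> \<psi>')"
      unfolding width_set_def by (rule INF_lower)
    also have "free a \<psi> = free a \<phi>" "free a \<psi>' = free a \<phi>'"
      using \<psi>(1) \<psi>'(1) by (auto simp: eq_class_def dest: equivclp_free)
    then have "width a (Bin Conj \<psi> \<psi>') = max (width_set a (eq_class a \<phi>))
      (max (width_set a (eq_class a \<phi>')) (ecard (free a \<phi> \<union> free a \<phi>')))"
      using \<psi>(2) \<psi>'(2) by (simp add: ac_simps)
    finally show "width_set a (eq_class a \<theta>) \<le> \<dots>" .
  next
    show "max (width_set a (eq_class a \<phi>))
      (max (width_set a (eq_class a \<phi>')) (ecard (free a \<phi> \<union> free a \<phi>'))) \<le>
      width_set a (eq_class a \<theta>)"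
      unfolding width_set_def[of a "eq_class a \<theta>"]
    proof (rule INF_greatest)
      fix \<psi> assume "\<psi> \<in> eq_class a \<theta>"
      then have \<psi>: "equivclp (step a) (Bin Conj \<phi> \<phi>') \<psi>"
        using assms(4) by (simp add: eq_class_def)
      have "width_set a (eq_class a \<phi>) \<le> width a \<psi>"
        using conj(1) std(1) disj(1) \<psi> by (rule width_set_conjunct_le)
      moreover have "width_set a (eq_class a \<phi>') \<le> width a \<psi>"
        \<comment> \<open>The second conjunct is treated as the first one after swapping the
          conjunction.\<close>
        using conj(2) std(2) disj(2) equivclp_trans[OF equivclp_Bin_commute \<psi>]
        by (rule width_set_conjunct_le)
      \<comment> \<open>Rewriting preserves the free variables of the whole formula, and
        \<open>\<psi>\<close> is a subformula of itself.\<close>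
      moreover have "ecard (free a \<phi> \<union> free a \<phi>') \<le> width a \<psi>"
        using equivclp_free[OF \<psi>] ecard_free_le_width[of a \<psi>] by simp
      ultimately show "max (width_set a (eq_class a \<phi>))
        (max (width_set a (eq_class a \<phi>')) (ecard (free a \<phi> \<union> free a \<phi>'))) \<le> width a \<psi>"
        by simp
    qed
  qed
  then show ?thesis by (simp add: width_set_restrict_map)
qed

end
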